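(* Consider an endogenously resolved evidence market with $n$ alternatives, evidence threshold $K$ and softmax temperature $\tau>0$, and a trader who arrives at time $t$ with total evidence set $E_t$, which, if submitted fully, would yield the belief $q(E_t)$ about market resolution. Then for every subset $E'_t\subseteq E_t$ submitted instead (withholding the rest), the corresponding belief $q(E'_t)$ satisfies $$\|q(E_t)-q(E'_t)\|_1\le \frac{1}{\tau}\,\frac{|E_t|}{K}.$$ Correspondingly, for any $\varepsilon>0$, if $\tau\ge \frac{|E_t|}{K\varepsilon}$ then $\|q(E_t)-q(E'_t)\|_1\le\varepsilon$ for every $E'_t\subseteq E_t$.
   Context: There are $n$ alternatives. Every atomic piece of evidence $e$ has a binary outcome $X_{ie}\in\{0,1\}$ for each alternative $i$ ($X_{ie}=1$ means $e$ supports $i$, $X_{ie}=0$ means $e$ refutes $i$). Endogenous resolution: once exactly $K$ pieces of evidence have accumulated, let $\theta_i=\frac1K\sum_e X_{ie}$ be the fraction of the $K$ pieces supporting $i$; the market resolves to alternative $j$ with probability $\mathrm{softmax}_j(\theta_1,\dots,\theta_n;\tau)=\exp(\theta_j/\tau)/\sum_{\ell}\exp(\theta_\ell/\tau)$. When trader $t$ arrives, $k(t)$ pieces have already been collected, $k_j(t)$ of which support alternative $j$; $k(t)+|E_t|\le K$. If the trader submits $E'_t\subseteq E_t$, let $|E'_{t,j}|$ be the number of pieces of $E'_t$ supporting $j$. The remaining $K-k(t)-|E'_t|$ pieces arrive in the future. The trader's belief about future evidence is a probability distribution over the sequence of outcome vectors $(X_{1e},\dots,X_{ne})\in\{0,1\}^n$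 of the future pieces in order of arrival, and this distribution does not depend on what the trader submits; $S_j$ is the (random) number of pieces supporting $j$ among the first $K-k(t)-|E'_t|$ pieces of this sequence. The score of $j$ from the trader's viewpoint is $\theta_{tj}(E'_t)=\frac{k_j(t)+|E'_{t,j}|+S_j}{K}$, and the trader's belief about market resolution when submitting $E'_t$ is the vector $q(E'_t)$ with entries $$q_{tj}(E'_t)=\mathbb{E}\left[\frac{\exp(\theta_{tj}(E'_t)/\tau)}{\sum_{\ell}\exp(\theta_{t\ell}(E'_t)/\tau)}\right],\qquad j=1,\dots,n,$$ the expectation being over the future evidence. *)

theory Defs
  imports "HOL-Probability.Probability_Mass_Function"
begin

text \<open>
  The alternatives are the elements of a finite type \<open>'a\<close> (so \<open>n = CARD('a)\<close>), and a binary outcome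
  vector is a function \<open>'a \<Rightarrow> bool\<close>, with \<open>True\<close> for ``supports'' and \<open>False\<close> for ``refutes''.
\<close>

definition softmax :: "real \<Rightarrow> ('a::finite \<Rightarrow> real) \<Rightarrow> 'a \<Rightarrow> real" where
  "softmax \<tau> \<theta> j = exp (\<theta> j / \<tau>) / (\<Sum>l\<in>UNIV. exp (\<theta> l / \<tau>))"

definition l1_norm :: "('a::finite \<Rightarrow> real) \<Rightarrow> real" where
  "l1_norm v = (\<Sum>j\<in>UNIV. \<bar>v j\<bar>)"

definition support_count :: "('a \<Rightarrow> 'e \<Rightarrow> bool) \<Rightarrow> 'e set \<Rightarrow> 'a \<Rightarrow> nat" where
  "support_count X A j = card {e \<in> A. X j e}"

definition future_support :: "('a \<Rightarrow> bool) list \<Rightarrow> nat \<Rightarrow> 'a \<Rightarrow> nat" where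
  "future_support xs m j = length (filter (\<lambda>x. x j) (take m xs))"

text \<open>
  In the next two definitions, \<open>K\<close> is the evidence threshold, \<open>k\<close> the number of pieces collected
  when the trader arrives, \<open>s j\<close> the number of those that support \<open>j\<close>, \<open>X i e\<close> the outcome of
  piece \<open>e\<close> for alternative \<open>i\<close>, and \<open>A\<close> the set the trader submits.  The list \<open>xs\<close> holds the
  outcome vectors of the future pieces in order of arrival.
\<close>

definition score ::
  "nat \<Rightarrow> nat \<Rightarrow> ('a \<Rightarrow> nat) \<Rightarrow> ('a \<Rightarrow> 'e \<Rightarrow> bool) \<Rightarrow> 'e set \<Rightarrow> ('a \<Rightarrow> bool) list \<Rightarrow> 'a \<Rightarrow> real" where
  "score K k s X A xs j =
     (real (s j) + real (support_count X A j) + real (future_support xs (K - k - card A) j)) / real K"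

text \<open>
  The distribution \<open>P\<close> of the future sequence is an argument separate from \<open>A\<close>: the submitted set
  only determines how long a prefix of the sequence is counted.
\<close>

definition resolution_belief ::
  "real \<Rightarrow> nat \<Rightarrow> nat \<Rightarrow> ('a::finite \<Rightarrow> nat) \<Rightarrow> ('a \<Rightarrow> 'e \<Rightarrow> bool) \<Rightarrow> ('a \<Rightarrow> bool) list pmf
     \<Rightarrow> 'e set \<Rightarrow> 'a \<Rightarrow> real" where
  "resolution_belief \<tau> K k s X P A j =
     measure_pmf.expectation P (\<lambda>xs. softmax \<tau> (score K k s X A xs) j)"

end

theory Submission
  imports Defs
begin

text \<open>
  A submission that withholds \<open>d\<close> pieces replaces them by \<open>d\<close> future pieces, so for every realisation
  of the future each score moves by at most \<open>d / K\<close>.  Softmax is Lipschitz from the maximum norm to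
  the \<open>\<ell>\<^sub>1\<close> norm with constant \<open>1 / \<tau>\<close>: the \<open>\<ell>\<^sub>1\<close> distance of two distributions is
  twice the largest gain of probability over events \<open>A\<close>, and the probability of \<open>A\<close> is the
  logistic function at the log-odds of \<open>A\<close>, which move by at most \<open>2 d / (K \<tau>)\<close>, while the logistic
  function has slope at most \<open>1 / 4\<close>.
\<close>

text \<open>With u = exp (- t), the logistic function has derivative u / (1 + u)^2, which is at most
  1/4 because (1 - u)^2 \<ge> 0. So t / 4 minus the logistic function is nondecreasing.\<close>

lemma logistic_diff_le:
  fixes x y :: real
  assumes "x \<le> y"
  shows "1 / (1 + exp (- y)) - 1 / (1 + exp (- x)) \<le> (y - x) / 4"
proof -
  define g :: "real \<Rightarrow> real" where "g t = t / 4 - 1 / (1 + exp (- t))" for t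
  have "\<exists>D. (g has_real_derivative D) (at t) \<and> 0 \<le> D" for t
  proof (intro exI conjI)
    have pos: "1 + exp (- t) > 0"
      by (simp add: add_pos_pos)
    show "(g has_real_derivative 1 / 4 - exp (- t) / (1 + exp (- t))\<^sup>2) (at t)"
      unfolding g_def using pos
      by (auto intro!: derivative_eq_intros simp: power2_eq_square)
    have "4 * exp (- t) \<le> (1 + exp (- t))\<^sup>2"
      using zero_le_power2[of "1 - exp (- t)"] by (simp add: power2_eq_square algebra_simps)
    then show "0 \<le> 1 / 4 - exp (- t) / (1 + exp (- t))\<^sup>2"
      using pos by (simp add: field_simps)
  qed
  then have "g x \<le> g y"
    using assms by (intro DERIV_nonneg_imp_nondecreasing[of x y g]) auto
  then show ?thesis
    by (simp add: g_def diff_divide_distrib)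
qed

text \<open>\<open>W\<close> and \<open>V\<close> are the weights of an event and of its complement,
  \<open>W'\<close> and \<open>V'\<close> the same after a change. Multiplying the two hypotheses
  shows that the odds grow by a factor of at most exp (2 * c), so the log-odds \<open>x\<close> grow
  by at most 2 * c; slope 1/4 turns this into c / 2.\<close>

lemma odds_ratio_diff_le:
  fixes V V' W W' c :: real
  assumes pos: "0 < V" "0 < W" "0 < V'" "0 < W'" and "0 \<le> c"
    and W': "W' \<le> exp c * W" and V: "V \<le> exp c * V'"
  shows "W' / (W' + V') - W / (W + V) \<le> c / 2"
proof -
  let ?\<sigma> = "\<lambda>t::real. 1 / (1 + exp (- t))"
  define x where "x = ln W - ln V"
  have W_eq: "W / (W + V) = ?\<sigma> x"
    using pos by (simp add: x_def exp_diff field_simps)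
  have "W' * V \<le> (exp c * W) * (exp c * V')"
    using W' V pos by (intro mult_mono) auto
  also have "\<dots> = exp (2 * c) * W * V'"
    by (simp add: exp_double power2_eq_square)
  finally have "exp (- (x + 2 * c)) \<le> V' / W'"
    using pos by (simp add: x_def exp_diff exp_minus exp_add field_simps)
  then have "1 / (1 + V' / W') \<le> ?\<sigma> (x + 2 * c)"
    using pos by (intro divide_left_mono) (auto intro!: mult_pos_pos add_pos_pos)
  moreover have "W' / (W' + V') = 1 / (1 + V' / W')"
    using pos by (simp add: field_simps)
  ultimately show ?thesis
    using logistic_diff_le[of x "x + 2 * c"] \<open>0 \<le> c\<close> unfolding W_eq by simp
qed

lemma softmax_denominator_pos: "0 < (\<Sum>l\<in>UNIV. exp (\<theta> l / \<tau>) :: real)"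
  for \<theta> :: "'a::finite \<Rightarrow> real"
  by (intro sum_pos) auto

lemma sum_softmax: "(\<Sum>j\<in>UNIV. softmax \<tau> \<theta> j) = 1"
  using softmax_denominator_pos[of \<theta> \<tau>]
  by (simp add: softmax_def flip: sum_divide_distrib)

lemma softmax_nonneg: "0 \<le> softmax \<tau> \<theta> j"
  by (simp add: softmax_def sum_nonneg)

lemma softmax_le_1: "softmax \<tau> \<theta> j \<le> 1"
  using member_le_sum[of j UNIV "softmax \<tau> \<theta>"] by (simp add: softmax_nonneg sum_softmax)

lemma softmax_event_diff_le:
  fixes \<theta> \<theta>' :: "'a::finite \<Rightarrow> real"
  assumes "\<tau> > 0" and close: "\<And>j. \<bar>\<theta> j - \<theta>' j\<bar> \<le> d"
  shows "(\<Sum>j\<in>A. softmax \<tau> \<theta>' j - softmax \<tau> \<theta> j) \<le> d / \<tau> / 2"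
proof -
  \<comment> \<open>Types are nonempty, so \<open>undefined\<close> serves as some
    alternative.\<close>
  have "0 \<le> d"
    using close[of undefined] by linarith
  \<comment> \<open>Log-odds exist only if the event and its complement both have positive weight.
    The two extreme events have probability 0 or 1 under both distributions.\<close>
  have "A = {} \<or> A = UNIV \<or> A \<noteq> {} \<and> - A \<noteq> {}"
    by auto
  then consider "A = {}" | "A = UNIV" | "A \<noteq> {}" "- A \<noteq> {}"
    by blast
  then show ?thesis
  proof cases
    case 3
    define w where "w u B = (\<Sum>j\<in>B. exp (u j / \<tau>))" for u :: "'a \<Rightarrow> real" and B
    have split: "(\<Sum>l\<in>UNIV. exp (u l / \<tau>)) = w u A + w u (- A)" for u
      unfolding w_def by (subst sum.union_disjoint[symmetric]) auto
    have event: "(\<Sum>j\<in>A. softmax \<tau> u j) = w u A / (w u A + w u (- A))" for u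
      by (simp add: softmax_def split w_def sum_divide_distrib)
    have pos: "0 < w u A" "0 < w u (- A)" for u
      using 3 unfolding w_def by (auto intro!: sum_pos)
    have growth: "w u B \<le> exp (d / \<tau>) * w v B" if "\<And>j. u j \<le> v j + d" for u v B
      unfolding w_def sum_distrib_left exp_add[symmetric] add_divide_distrib[symmetric]
      using that \<open>\<tau> > 0\<close> by (intro sum_mono) (simp add: divide_right_mono add.commute)
    \<comment> \<open>Only changes that raise the odds of \<open>A\<close> need control: its own
      weight growing and that of the complement shrinking.\<close>
    have "w \<theta>' A \<le> exp (d / \<tau>) * w \<theta> A" "w \<theta> (- A) \<le> exp (d / \<tau>) * w \<theta>' (- A)"
      using close by (intro growth; simp add: abs_le_iff algebra_simps)+
    then show ?thesis
      unfolding sum_subtractf event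
      using pos \<open>0 \<le> d\<close> \<open>\<tau> > 0\<close> by (intro odds_ratio_diff_le) auto
  qed (use \<open>0 \<le> d\<close> \<open>\<tau> > 0\<close> in \<open>simp_all add: sum_subtractf sum_softmax\<close>)
qed

text \<open>Pointwise, the absolute value is twice the positive part minus the value itself, and the
  values cancel in total.\<close>

lemma l1_norm_eq_double_sum_pos:
  fixes v :: "'a::finite \<Rightarrow> real"
  assumes "(\<Sum>j\<in>UNIV. v j) = 0"
  shows "l1_norm v = 2 * (\<Sum>j | 0 \<le> v j. v j)"
proof -
  have "l1_norm v = (\<Sum>j\<in>UNIV. 2 * (if 0 \<le> v j then v j else 0) - v j)"
    unfolding l1_norm_def by (intro sum.cong) auto
  also have "\<dots> = 2 * (\<Sum>j | 0 \<le> v j. v j)"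
    using assms by (simp add: sum_subtractf sum.If_cases flip: sum_distrib_left)
  finally show ?thesis .
qed

lemma softmax_l1_lipschitz:
  fixes \<theta> \<theta>' :: "'a::finite \<Rightarrow> real"
  assumes "\<tau> > 0" and "\<And>j. \<bar>\<theta> j - \<theta>' j\<bar> \<le> d"
  shows "l1_norm (\<lambda>j. softmax \<tau> \<theta> j - softmax \<tau> \<theta>' j) \<le> d / \<tau>"
proof -
  have "(\<Sum>j\<in>A. softmax \<tau> \<theta> j - softmax \<tau> \<theta>' j) \<le> d / \<tau> / 2" for A
    using assms by (intro softmax_event_diff_le) (simp_all add: abs_minus_commute)
  \<comment> \<open>This event has the largest gain in probability; the factor 2 in the norm cancels
    the 1/2 in the event bound.\<close>
  from this[of "{j. 0 \<le> softmax \<tau> \<theta> j - softmax \<tau> \<theta>' j}"] show ?thesis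
    by (subst l1_norm_eq_double_sum_pos) (simp_all only: sum_subtractf sum_softmax, simp_all)
qed

lemma future_support_add:
  "future_support xs (m + d) j = future_support xs m j + future_support (drop m xs) d j"
  by (simp add: future_support_def take_add)

lemma future_support_le: "future_support xs d j \<le> d"
  unfolding future_support_def
  by (rule order_trans[OF length_filter_le]) simp

lemma support_count_Diff:
  assumes "finite B" "A \<subseteq> B"
  shows "support_count X B j = support_count X A j + support_count X (B - A) j"
proof -
  have "{e \<in> B. X j e} = {e \<in> A. X j e} \<union> {e \<in> B - A. X j e}"
    using assms by auto
  moreover have "finite A"
    using assms finite_subset by blast
  ultimately show ?thesis
    unfolding support_count_def using assms by (simp add: card_Un_disjoint disjoint_iff)
qed

lemma support_count_le: "finite A \<Longrightarrow> support_count X A j \<le> card A"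
  unfolding support_count_def by (auto intro: card_mono)

text \<open>Both scores read the same sequence \<open>xs\<close>, so its first \<open>m\<close>
  pieces cancel. What remains is the support from the \<open>d\<close> withheld pieces minus that
  from the \<open>d\<close> future pieces replacing them. Both counts lie between 0 and
  \<open>d\<close>, so they differ by at most \<open>d\<close> rather than 2 * d.\<close>

lemma score_diff_le:
  assumes "K > 0" "finite E" "k + card E \<le> K" "E' \<subseteq> E"
  shows "\<bar>score K k s X E xs j - score K k s X E' xs j\<bar> \<le> real (card (E - E')) / real K"
proof -
  define d m where "d = card (E - E')" and "m = K - k - card E"
  have "card E = card E' + d"
    unfolding d_def using assms
    by (metis card_Diff_subset card_mono finite_subset le_add_diff_inverse)
  then have "K - k - card E' = m + d"
    unfolding m_def using assms by simp
  moreover have "K - k - card E = m"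
    by (simp add: m_def)
  ultimately have "score K k s X E xs j - score K k s X E' xs j =
      (real (support_count X (E - E') j) - real (future_support (drop m xs) d j)) / real K"
    unfolding score_def
    by (simp add: support_count_Diff[OF assms(2,4)] future_support_add
        del: diff_diff_left flip: diff_divide_distrib)
  moreover have "support_count X (E - E') j \<le> d"
    unfolding d_def using assms by (intro support_count_le) auto
  moreover have "future_support (drop m xs) d j \<le> d"
    by (rule future_support_le)
  ultimately show ?thesis
    unfolding d_def[symmetric] using \<open>K > 0\<close>
    by (simp add: abs_divide divide_right_mono abs_le_iff)
qed

text \<open>The absolute value moves inside each expectation, and the finite sum over alternatives
  is then exchanged with the expectation.\<close>

lemma l1_norm_expectation_le:
  fixes f :: "'b \<Rightarrow> 'a::finite \<Rightarrow> real"
  assumes int: "\<And>j. integrable (measure_pmf P) (\<lambda>x. f x j)"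
    and bound: "\<And>x. l1_norm (f x) \<le> C"
  shows "l1_norm (\<lambda>j. measure_pmf.expectation P (\<lambda>x. f x j)) \<le> C"
proof -
  have "l1_norm (\<lambda>j. measure_pmf.expectation P (\<lambda>x. f x j))
      \<le> (\<Sum>j\<in>UNIV. measure_pmf.expectation P (\<lambda>x. \<bar>f x j\<bar>))"
    unfolding l1_norm_def by (intro sum_mono integral_abs_bound)
  also have "\<dots> = measure_pmf.expectation P (\<lambda>x. l1_norm (f x))"
    unfolding l1_norm_def using int by (simp add: Bochner_Integration.integral_sum)
  also have "\<dots> \<le> measure_pmf.expectation P (\<lambda>x. C)"
    using int bound by (intro integral_mono) (simp_all add: l1_norm_def)
  finally show ?thesis
    by simp
qed

lemma integrable_softmax: "integrable (measure_pmf P) (\<lambda>x. softmax \<tau> (g x) j)"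
  by (rule measure_pmf.integrable_const_bound[where B = 1])
    (auto simp: softmax_nonneg softmax_le_1)

lemma resolution_belief_l1_diff_le:
  fixes s :: "'a::finite \<Rightarrow> nat"
  assumes "\<tau> > 0" "K > 0" "finite E" "k + card E \<le> K" "E' \<subseteq> E"
  shows "l1_norm (\<lambda>j. resolution_belief \<tau> K k s X P E j - resolution_belief \<tau> K k s X P E' j)
    \<le> real (card (E - E')) / real K / \<tau>"
  \<comment> \<open>Both beliefs average over the same \<open>P\<close>, so their difference is the
    expectation of a difference taken realisation by realisation.\<close>
  unfolding resolution_belief_def
    Bochner_Integration.integral_diff[OF integrable_softmax integrable_softmax, symmetric]
  using assms
  by (intro l1_norm_expectation_le softmax_l1_lipschitz score_diff_le
      Bochner_Integration.integrable_diff integrable_softmax)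

theorem theorem1:
  fixes \<tau> :: real and K k :: nat
    and s :: "'a::finite \<Rightarrow> nat"
    and X :: "'a \<Rightarrow> 'e \<Rightarrow> bool"
    and P :: "('a \<Rightarrow> bool) list pmf"
    and E :: "'e set"
  assumes "\<tau> > 0" and "K > 0"
    and "finite E"
    and "k + card E \<le> K"
    and "\<And>j. s j \<le> k"
    and "\<And>xs. xs \<in> set_pmf P \<Longrightarrow> K - k \<le> length xs"
  defines "q \<equiv> resolution_belief \<tau> K k s X P"
  shows "(\<forall>E'. E' \<subseteq> E \<longrightarrow>
            l1_norm (\<lambda>j. q E j - q E' j) \<le> 1 / \<tau> * (real (card E) / real K)) \<and>
         (\<forall>\<epsilon>>0. \<tau> \<ge> real (card E) / (real K * \<epsilon>) \<longrightarrow>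
            (\<forall>E'. E' \<subseteq> E \<longrightarrow> l1_norm (\<lambda>j. q E j - q E' j) \<le> \<epsilon>))"
proof -
  have bound: "l1_norm (\<lambda>j. q E j - q E' j) \<le> 1 / \<tau> * (real (card E) / real K)" if "E' \<subseteq> E" for E'
  proof -
    have "l1_norm (\<lambda>j. q E j - q E' j) \<le> real (card (E - E')) / real K / \<tau>"
      unfolding q_def using assms(1-4) that by (rule resolution_belief_l1_diff_le)
    \<comment> \<open>The bound is largest when everything is withheld.\<close>
    also have "\<dots> \<le> real (card E) / real K / \<tau>"
      using assms(1-3) by (intro divide_right_mono) (auto intro: card_mono)
    finally show ?thesis
      by (simp add: mult.commute)
  qed
  moreover have "1 / \<tau> * (real (card E) / real K) \<le> \<epsilon>"
    if "\<epsilon> > 0" "\<tau> \<ge> real (card E) / (real K * \<epsilon>)" for \<epsilon>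
    using that assms(1,2) by (simp add: field_simps)
  ultimately show ?thesis
    by (meson order_trans)
qed

end
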